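(* Let $[a,b]$ be a real interval, let $1\le p<\infty$, let $\alpha,\beta\in\mathbb{C}$ with $\operatorname{Re}(\alpha)>0$, $\operatorname{Re}(\beta)>0$, and let $R\in\mathbb{R}^+$ satisfy $R>(b-a)^{\operatorname{Re}(\beta)}$. Let $\mathcal{A}$ be analytic on the complex disc $\mathcal{D}(0,R)$, and let $\varphi\in C^1[a,b]$ be a non-negative increasing function. Then ${}^{\mathcal{A}}_{a}I^{\alpha,\beta}_{\varphi(x)}$ is a well-defined bounded operator from the space $L^p_\varphi[a,b]$ to itself, with $$\left\|{}^{\mathcal{A}}_{a}I^{\alpha,\beta}_{\varphi(x)}u\right\|_{L^p_\varphi}\le K\|u\|_{L^p_\varphi},$$ where the constant $K$ is defined by $$K=\frac{(\varphi(b)-\varphi(a))^{\alpha}}{\alpha}\ \sup_{|\tau|<(\varphi(b)-\varphi(a))^{\beta}}|\mathcal{A}(\tau)| .$$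
   Context: $L^p_\varphi[a,b]$ is the space of Lebesgue measurable functions $u:[a,b]\to\mathbb{C}$ for which $\|u\|_{L^p_\varphi}=\left(\int_a^b|u(x)|^p\varphi'(x)\,dx\right)^{1/p}<\infty$. The generalised fractional integral with analytic kernel $\mathcal{A}(x)=\sum_{n\ge0}a_nx^n$ with respect to $\varphi$ is $${}^{\mathcal{A}}_{a}I^{\alpha,\beta}_{\varphi(x)}u(x)=\int_a^x\varphi'(t)\,[\varphi(x)-\varphi(t)]^{\alpha-1}\,\mathcal{A}\big([\varphi(x)-\varphi(t)]^{\beta}\big)\,u(t)\,dt ,$$ where the coefficients $a_n$ may depend on $\alpha,\beta$.
   Formalization: The condition R > (b−a)^{Re β} is replaced by R > (φ(b)−φ(a))^{Re β}, since otherwise A may be evaluated outside its disc; in K, α and β are replaced by Re α and Re β, since the printed K is not real for complex α, β. *)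

theory Defs
  imports "HOL-Complex_Analysis.Complex_Analysis"
begin

text \<open>
  Throughout, \<open>\<phi>'\<close> is an explicit argument standing for the derivative of \<open>\<phi>\<close> on
  \<open>{a..b}\<close>, one-sided at the end points; \<open>C1_on_interval\<close> ties the two together.
\<close>

definition C1_on_interval ::
  "real \<Rightarrow> real \<Rightarrow> (real \<Rightarrow> real) \<Rightarrow> (real \<Rightarrow> real) \<Rightarrow> bool" where
  "C1_on_interval a b \<phi> \<phi>' \<longleftrightarrow>
     (\<forall>x\<in>{a..b}. (\<phi> has_real_derivative \<phi>' x) (at x within {a..b})) \<and>
     continuous_on {a..b} \<phi>'"

text \<open>
  Elements of \<open>Lp_phi\<close> are functions, not classes. The seminorm below vanishes exactly on the
  functions that are zero almost everywhere for the measure \<open>\<phi>'(x) dx\<close>, so identities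
  between elements of the space are stated almost everywhere for \<open>phi_measure\<close>. (For
  increasing \<open>\<phi>\<close> the derivative may vanish on a set of positive Lebesgue measure.)
\<close>

definition phi_measure :: "real \<Rightarrow> real \<Rightarrow> (real \<Rightarrow> real) \<Rightarrow> real measure" where
  "phi_measure a b \<phi>' = density (lebesgue_on {a..b}) (\<lambda>x. ennreal (\<phi>' x))"

definition Lp_phi :: "real \<Rightarrow> real \<Rightarrow> real \<Rightarrow> (real \<Rightarrow> real) \<Rightarrow> (real \<Rightarrow> complex) set" where
  "Lp_phi p a b \<phi>' =
     {u. u \<in> borel_measurable (lebesgue_on {a..b}) \<and>
         (\<integral>\<^sup>+ x. ennreal (cmod (u x) powr p * \<phi>' x) \<partial>lebesgue_on {a..b}) < \<infinity>}"

definition Lp_phi_norm ::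
  "real \<Rightarrow> real \<Rightarrow> real \<Rightarrow> (real \<Rightarrow> real) \<Rightarrow> (real \<Rightarrow> complex) \<Rightarrow> real" where
  "Lp_phi_norm p a b \<phi>' u =
     (LINT x|lebesgue_on {a..b}. cmod (u x) powr p * \<phi>' x) powr (1 / p)"

definition frac_integrand ::
  "(complex \<Rightarrow> complex) \<Rightarrow> complex \<Rightarrow> complex \<Rightarrow> (real \<Rightarrow> real) \<Rightarrow> (real \<Rightarrow> real) \<Rightarrow>
   (real \<Rightarrow> complex) \<Rightarrow> real \<Rightarrow> real \<Rightarrow> complex" where
  "frac_integrand A \<alpha> \<beta> \<phi> \<phi>' u x t =
     complex_of_real (\<phi>' t) * complex_of_real (\<phi> x - \<phi> t) powr (\<alpha> - 1) *
     A (complex_of_real (\<phi> x - \<phi> t) powr \<beta>) * u t"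

text \<open>
  The Lebesgue integral has value 0 at those \<open>x\<close> where the integrand is not integrable, so
  existence of the integral has to be asserted separately.
\<close>

definition frac_integral ::
  "(complex \<Rightarrow> complex) \<Rightarrow> complex \<Rightarrow> complex \<Rightarrow> (real \<Rightarrow> real) \<Rightarrow> (real \<Rightarrow> real) \<Rightarrow>
   real \<Rightarrow> (real \<Rightarrow> complex) \<Rightarrow> real \<Rightarrow> complex" where
  "frac_integral A \<alpha> \<beta> \<phi> \<phi>' a u x =
     (LINT t|lebesgue_on {a..x}. frac_integrand A \<alpha> \<beta> \<phi> \<phi>' u x t)"

text \<open>
  For complex \<open>\<alpha>\<close> and \<open>\<beta>\<close> the constant involves only their real parts:
  \<open>(\<phi>(b) - \<phi>(a)) powr Re(\<alpha>) / Re(\<alpha>)\<close> is the integral of \<open>|s powr (\<alpha> - 1)|\<close> over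
  \<open>0 < s < \<phi>(b) - \<phi>(a)\<close>, and \<open>|s powr \<beta>| = s powr Re(\<beta>)\<close> for \<open>s > 0\<close>.
\<close>

definition frac_bound ::
  "(complex \<Rightarrow> complex) \<Rightarrow> complex \<Rightarrow> complex \<Rightarrow> (real \<Rightarrow> real) \<Rightarrow> real \<Rightarrow> real \<Rightarrow> real" where
  "frac_bound A \<alpha> \<beta> \<phi> a b =
     (\<phi> b - \<phi> a) powr Re \<alpha> / Re \<alpha> *
     (SUP \<tau>\<in>{\<tau>. cmod \<tau> < (\<phi> b - \<phi> a) powr Re \<beta>}. cmod (A \<tau>))"

end

theory Submission
  imports Defs
begin

text \<open>
  For the measure \<open>d\<mu> = \<phi>'(t) dt\<close> the operator has a kernel dominated by
  \<open>S * (\<phi>(x) - \<phi>(t)) powr (Re \<alpha> - 1)\<close> on \<open>t \<le> x\<close>, where \<open>S\<close> bounds \<open>A\<close> on the relevant disc.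
  Substituting \<open>y = \<phi>(t)\<close>, or \<open>y = \<phi>(x)\<close>, shows that the integral of this kernel in either
  variable is at most \<open>K\<close>, so the Schur test (Hoelder's inequality for the measure with
  density \<open>k(x, \<cdot>)\<close>, then Tonelli) bounds the operator norm on \<open>L\<^sup>p\<close> by \<open>K\<close>.
\<close>

section \<open>Change of variables and integrals of powers\<close>

text \<open>The one-sided derivatives at \<open>a\<close> and \<open>b\<close> are made two-sided
  first: on \<open>{a..b}\<close> the function \<open>g\<close> agrees, up to a constant, with a
  primitive \<open>G\<close> of a continuous extension of \<open>g'\<close>, and the substitution is
  carried out with \<open>G\<close>.\<close>

lemma nn_integral_substitution_within:
  fixes g g' :: "real \<Rightarrow> real" and f :: "real \<Rightarrow> ennreal"
  assumes "f \<in> borel_measurable borel"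
    and deriv: "\<And>x. x \<in> {a..b} \<Longrightarrow> (g has_real_derivative g' x) (at x within {a..b})"
    and cont: "continuous_on {a..b} g'"
    and nonneg: "\<And>x. x \<in> {a..b} \<Longrightarrow> 0 \<le> g' x"
    and "a < b"
  shows "(\<integral>\<^sup>+x. f (g x) * ennreal (g' x) \<partial>lebesgue_on {a..b}) =
         (\<integral>\<^sup>+y. f y * indicator {g a..g b} y \<partial>lborel)"
proof -
  \<comment> \<open>Clamping the argument extends \<open>g'\<close> continuously to the whole line,
    constant on either side of \<open>{a..b}\<close>.\<close>
  define h where "h x = g' (max a (min b x))" for x
  have cont_h: "continuous_on S h" for S
  proof -
    have "continuous_on S (g' \<circ> (\<lambda>x. max a (min b x)))"
      using \<open>a < b\<close> by (intro continuous_on_compose continuous_intros continuous_on_subset[OF cont]) auto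
    then show ?thesis by (simp add: h_def comp_def)
  qed
  \<comment> \<open>Starting at \<open>a - 1\<close> makes every point of \<open>{a..b}\<close>
    interior to \<open>{a - 1..b + 1}\<close>, so \<open>G\<close> has a full derivative even at
    \<open>a\<close> and \<open>b\<close>.\<close>
  define G where "G x = integral {a - 1..x} h" for x
  have G_deriv: "(G has_real_derivative h x) (at x)" if "x \<in> {a..b}" for x
  proof -
    have "(G has_real_derivative h x) (at x within {a - 1..b + 1})"
      unfolding G_def using that by (intro integral_has_real_derivative cont_h) auto
    moreover have "x \<in> interior {a - 1..b + 1}"
      using that by auto
    ultimately show ?thesis
      by (metis at_within_interior)
  qed
  have h_eq: "h x = g' x" if "x \<in> {a..b}" for x
    using that by (simp add: h_def max_absorb2 min_absorb2)
  have "\<exists>c. \<forall>x\<in>{a..b}. g x - G x = c"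
  proof (rule has_field_derivative_zero_constant)
    fix x assume x: "x \<in> {a..b}"
    show "((\<lambda>x. g x - G x) has_field_derivative 0) (at x within {a..b})"
      using DERIV_diff[OF deriv[OF x] has_field_derivative_at_within[OF G_deriv[OF x]]] h_eq[OF x] by simp
  qed auto
  then obtain c where c: "\<And>x. x \<in> {a..b} \<Longrightarrow> g x = G x + c"
    by (metis diff_add_cancel add.commute)
  have "(\<integral>\<^sup>+x. f (g x) * ennreal (g' x) \<partial>lebesgue_on {a..b}) =
        (\<integral>\<^sup>+x. f (g x) * ennreal (g' x) * indicator {a..b} x \<partial>lborel)"
    by (simp add: nn_integral_restrict_space nn_integral_completion)
  also have "\<dots> = (\<integral>\<^sup>+x. f (G x + c) * ennreal (h x) * indicator {a..b} x \<partial>lborel)"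
    by (intro nn_integral_cong) (auto simp: h_eq c indicator_def)
  also have "\<dots> = (\<integral>\<^sup>+y. f y * indicator {G a + c..G b + c} y \<partial>lborel)"
    using assms h_eq
    by (intro nn_integral_substitution_aux[symmetric, where g = "\<lambda>x. G x + c"] cont_h)
       (auto intro!: derivative_eq_intros G_deriv)
  also have "{G a + c..G b + c} = {g a..g b}"
    using c \<open>a < b\<close> by auto
  finally show ?thesis .
qed

text \<open>For \<open>s < 1\<close> the integrand is unbounded near 0, but
  \<open>s - 1 > -1\<close> keeps it integrable. Translation and reflection carry this over to a
  singularity at either end of an interval.\<close>

lemma nn_integral_powr_0:
  fixes s :: real
  assumes "s > 0" "0 \<le> L"
  shows "(\<integral>\<^sup>+y. ennreal (y powr (s - 1)) * indicator {0..L} y \<partial>lborel) = ennreal (L powr s / s)"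
  using has_integral_powr_from_0[of "s - 1" L] assms
  by (intro nn_integral_has_integral_lebesgue') auto

lemma nn_integral_powr_from:
  fixes s :: real
  assumes "s > 0" "u \<le> v"
  shows "(\<integral>\<^sup>+y. ennreal ((y - u) powr (s - 1)) * indicator {u..v} y \<partial>lborel) = ennreal ((v - u) powr s / s)"
proof -
  have "(\<integral>\<^sup>+y. ennreal ((y - u) powr (s - 1)) * indicator {u..v} y \<partial>lborel) =
    (\<integral>\<^sup>+y. ennreal (y powr (s - 1)) * indicator {0..v - u} y \<partial>lborel)"
    by (subst nn_integral_real_affine[where c = 1 and t = u])
       (auto simp: indicator_def algebra_simps intro!: nn_integral_cong)
  then show ?thesis using nn_integral_powr_0[of s "v - u"] assms by simp
qed

lemma nn_integral_powr_to:
  fixes s :: real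
  assumes "s > 0" "u \<le> v"
  shows "(\<integral>\<^sup>+y. ennreal ((v - y) powr (s - 1)) * indicator {u..v} y \<partial>lborel) = ennreal ((v - u) powr s / s)"
proof -
  have "(\<integral>\<^sup>+y. ennreal ((v - y) powr (s - 1)) * indicator {u..v} y \<partial>lborel) =
    (\<integral>\<^sup>+y. ennreal (y powr (s - 1)) * indicator {0..v - u} y \<partial>lborel)"
    by (subst nn_integral_real_affine[where c = "-1" and t = v])
       (auto simp: indicator_def algebra_simps intro!: nn_integral_cong)
  then show ?thesis using nn_integral_powr_0[of s "v - u"] assms by simp
qed

section \<open>Hoelder's inequality for a mean, and the Schur test\<close>

text \<open>This is Hoelder's inequality for \<open>w\<close> against the constant 1. Integrating
  Young's inequality at a well-chosen scale \<open>l\<close> treats \<open>p = 1\<close> together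
  with \<open>p > 1\<close>, without a conjugate exponent.\<close>

lemma ennreal_powr_mean_le:
  fixes w :: "'a \<Rightarrow> real" and C Q p :: real
  assumes w[measurable]: "w \<in> borel_measurable N" and w0: "\<And>x. 0 \<le> w x"
    and "1 \<le> p" "0 \<le> C" "0 \<le> Q"
    and mass: "emeasure N (space N) \<le> ennreal C"
    and moment: "(\<integral>\<^sup>+x. ennreal (w x powr p) \<partial>N) \<le> ennreal Q"
  shows "(\<integral>\<^sup>+x. ennreal (w x) \<partial>N) \<le> ennreal (C powr (1 - 1 / p) * Q powr (1 / p))"
proof (cases "C = 0 \<or> Q = 0")
  case True
  \<comment> \<open>If \<open>C\<close> or \<open>Q\<close> is 0, the scale \<open>l\<close> used in
    the other case would degenerate to 0.\<close>
  have "AE x in N. w x = 0"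
  proof (cases "C = 0")
    case True
    with mass have "emeasure N (space N) = 0" by simp
    then show ?thesis by (intro AE_I[where N = "space N"]) auto
  next
    case False
    with \<open>C = 0 \<or> Q = 0\<close> moment have "(\<integral>\<^sup>+x. ennreal (w x powr p) \<partial>N) = 0" by simp
    then have "AE x in N. ennreal (w x powr p) = 0"
      by (subst (asm) nn_integral_0_iff_AE) auto
    then show ?thesis by eventually_elim auto
  qed
  then have "(\<integral>\<^sup>+x. ennreal (w x) \<partial>N) = 0"
    by (subst nn_integral_0_iff_AE) auto
  then show ?thesis by simp
next
  case False
  then have C: "C > 0" and Q: "Q > 0" using assms by auto
  \<comment> \<open>A constant function with value \<open>l\<close> on a space of mass
    \<open>C\<close> has \<open>p\<close>-th moment exactly \<open>Q\<close>; this is the equality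
    case, so Young's inequality at \<open>l\<close> loses nothing.\<close>
  define l where "l = (Q / C) powr (1 / p)"
  have l: "l > 0" using C Q by (simp add: l_def)
  have lp: "l powr p = Q / C" using C Q \<open>1 \<le> p\<close> by (simp add: l_def powr_powr)
  \<comment> \<open>The tangent line of the convex function \<open>x powr p\<close> at
    \<open>l\<close>, solved for \<open>x\<close>.\<close>
  have young: "w x \<le> (l powr (1 - p) / p) * w x powr p + (1 - 1 / p) * l" for x
  proof (cases "w x = 0")
    case False
    then have "w x > 0" using w0[of x] by simp
    have "(w x powr p) powr (1 / p) * (l powr p) powr (1 - 1 / p)
      \<le> (1 / p) * w x powr p + (1 - 1 / p) * l powr p"
      using \<open>1 \<le> p\<close> l \<open>w x > 0\<close> by (intro Youngs_inequality_0) auto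
    then have "w x * l powr (p - 1) \<le> (1 / p) * w x powr p + (1 - 1 / p) * l powr p"
      using \<open>1 \<le> p\<close> \<open>w x > 0\<close> by (simp add: powr_powr right_diff_distrib)
    then have "(w x * l powr (p - 1)) * l powr (1 - p) \<le> ((1 / p) * w x powr p + (1 - 1 / p) * l powr p) * l powr (1 - p)"
      by (intro mult_right_mono) auto
    moreover have "l powr (p - 1) * l powr (1 - p) = 1" "l powr p * l powr (1 - p) = l"
      using l by (simp_all flip: powr_add)
    ultimately show ?thesis by (simp add: algebra_simps)
  qed (use \<open>1 \<le> p\<close> l in auto)
  have "(\<integral>\<^sup>+x. ennreal (w x) \<partial>N) \<le> (\<integral>\<^sup>+x. ennreal (l powr (1 - p) / p) * ennreal (w x powr p) + ennreal ((1 - 1 / p) * l) \<partial>N)"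
    using young \<open>1 \<le> p\<close> l
    by (intro nn_integral_mono) (auto simp: ennreal_mult'[symmetric] ennreal_plus[symmetric] simp del: ennreal_plus intro!: ennreal_leI)
  also have "\<dots> = ennreal (l powr (1 - p) / p) * (\<integral>\<^sup>+x. ennreal (w x powr p) \<partial>N) + ennreal ((1 - 1 / p) * l) * emeasure N (space N)"
    by (simp add: nn_integral_add nn_integral_cmult)
  also have "\<dots> \<le> ennreal (l powr (1 - p) / p) * ennreal Q + ennreal ((1 - 1 / p) * l) * ennreal C"
    using mass moment by (intro add_mono mult_left_mono) auto
  also have "\<dots> = ennreal (l powr (1 - p) / p * Q + (1 - 1 / p) * l * C)"
    using C Q l \<open>1 \<le> p\<close>
    by (subst ennreal_plus) (auto simp flip: ennreal_mult')
  also have "l powr (1 - p) / p * Q + (1 - 1 / p) * l * C = C * l"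
  proof -
    have "l powr (1 - p) * Q = C * l"
      using lp C l by (simp add: powr_diff field_simps)
    then show ?thesis by (simp add: field_simps)
  qed
  also have "C * l = C powr (1 - 1 / p) * Q powr (1 / p)"
    using C Q by (simp add: l_def powr_diff powr_divide)
  finally show ?thesis .
qed

text \<open>The principal logarithm of a nonzero real \<open>s\<close> is
  \<open>ln \<bar>s\<bar>\<close>, plus \<open>pi * \<i>\<close> when \<open>s\<close> is negative;
  this case formula is visibly measurable.\<close>

lemma borel_measurable_complex_of_real_powr [measurable]:
  "(\<lambda>s. complex_of_real s powr z) \<in> borel_measurable borel"
proof -
  have "(\<lambda>s. complex_of_real s powr z) =
    (\<lambda>s. if s = 0 then 0 else exp (z * (of_real (ln \<bar>s\<bar>) + (if s < 0 then pi else 0) * \<i>)))"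
    by (rule ext) (auto simp: powr_def Ln_of_real')
  also have "\<dots> \<in> borel_measurable borel" by measurable
  finally show ?thesis .
qed


text \<open>The row bound contributes the factor \<open>C powr (p - 1)\<close> and the column bound
  the remaining factor \<open>C\<close>. The bound is stated for any \<open>J\<close> below the
  transform of \<open>w\<close>, so that it can be applied to the modulus of a complex
  integral.\<close>

lemma Schur_test:
  fixes k :: "'a \<Rightarrow> 'a \<Rightarrow> real" and w :: "'a \<Rightarrow> real"
  assumes "sigma_finite_measure M"
    and k[measurable]: "case_prod k \<in> borel_measurable (M \<Otimes>\<^sub>M M)"
    and k0: "\<And>x t. 0 \<le> k x t"
    and row: "\<And>x. x \<in> space M \<Longrightarrow> (\<integral>\<^sup>+t. ennreal (k x t) \<partial>M) \<le> ennreal C"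
    and column: "\<And>t. t \<in> space M \<Longrightarrow> (\<integral>\<^sup>+x. ennreal (k x t) \<partial>M) \<le> ennreal C"
    and w[measurable]: "w \<in> borel_measurable M" and w0: "\<And>t. 0 \<le> w t"
    and "0 \<le> C" "1 \<le> p"
    and finite: "(\<integral>\<^sup>+t. ennreal (w t powr p) \<partial>M) < \<infinity>"
  shows Schur_test_finite: "AE x in M. (\<integral>\<^sup>+t. ennreal (k x t * w t) \<partial>M) < \<infinity>"
    and Schur_test_bound: "\<And>J. (\<And>x. x \<in> space M \<Longrightarrow> 0 \<le> J x) \<Longrightarrow>
      (\<And>x. x \<in> space M \<Longrightarrow> ennreal (J x) \<le> (\<integral>\<^sup>+t. ennreal (k x t * w t) \<partial>M)) \<Longrightarrow>
      (\<integral>\<^sup>+x. ennreal (J x powr p) \<partial>M) \<le> ennreal (C powr p) * (\<integral>\<^sup>+t. ennreal (w t powr p) \<partial>M)"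
proof -
  interpret sigma_finite_measure M by fact
  interpret pair_sigma_finite M M ..
  \<comment> \<open>\<open>P x\<close> is the \<open>p\<close>-th moment of \<open>w\<close> for the
    measure with density \<open>k x\<close>; Tonelli turns its integral into one over the columns of
    \<open>k\<close>.\<close>
  define P where "P x = (\<integral>\<^sup>+t. ennreal (k x t * w t powr p) \<partial>M)" for x
  have P_meas [measurable]: "P \<in> borel_measurable M"
    unfolding P_def by measurable
  have "(\<integral>\<^sup>+x. P x \<partial>M) = (\<integral>\<^sup>+t. \<integral>\<^sup>+x. ennreal (k x t * w t powr p) \<partial>M \<partial>M)"
    unfolding P_def by (intro Fubini'[symmetric]) measurable
  also have "\<dots> = (\<integral>\<^sup>+t. (\<integral>\<^sup>+x. ennreal (k x t) \<partial>M) * ennreal (w t powr p) \<partial>M)"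
    using k0 by (intro nn_integral_cong) (simp add: ennreal_mult nn_integral_multc)
  also have "\<dots> \<le> (\<integral>\<^sup>+t. ennreal C * ennreal (w t powr p) \<partial>M)"
    by (intro nn_integral_mono mult_right_mono column) auto
  also have "\<dots> = ennreal C * (\<integral>\<^sup>+t. ennreal (w t powr p) \<partial>M)"
    by (simp add: nn_integral_cmult)
  finally have P_le: "(\<integral>\<^sup>+x. P x \<partial>M) \<le> ennreal C * (\<integral>\<^sup>+t. ennreal (w t powr p) \<partial>M)" .
  also have "\<dots> < \<infinity>"
    using finite by (simp add: ennreal_mult_less_top)
  finally have P_finite: "AE x in M. P x \<noteq> \<infinity>"
    by (intro nn_integral_PInf_AE) auto
  have mean: "(\<integral>\<^sup>+t. ennreal (k x t * w t) \<partial>M) \<le> ennreal (C powr (1 - 1 / p) * enn2real (P x) powr (1 / p))"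
    if x: "x \<in> space M" and "P x \<noteq> \<infinity>" for x
  proof -
    \<comment> \<open>The row bound says that this measure has mass at most \<open>C\<close>, so the
      mean inequality applies with \<open>Q\<close> equal to \<open>P x\<close>.\<close>
    let ?N = "density M (\<lambda>t. ennreal (k x t))"
    have [measurable]: "k x \<in> borel_measurable M"
      using x by measurable
    have "(\<integral>\<^sup>+t. ennreal (w t) \<partial>?N) \<le> ennreal (C powr (1 - 1 / p) * enn2real (P x) powr (1 / p))"
    proof (rule ennreal_powr_mean_le)
      show "emeasure ?N (space ?N) \<le> ennreal C"
        using row[OF x] by (simp add: emeasure_density cong: nn_integral_cong_simp)
      have "(\<integral>\<^sup>+t. ennreal (w t powr p) \<partial>?N) = P x"
        using k0 by (simp add: nn_integral_density P_def ennreal_mult)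
      then show "(\<integral>\<^sup>+t. ennreal (w t powr p) \<partial>?N) \<le> ennreal (enn2real (P x))"
        using \<open>P x \<noteq> \<infinity>\<close> by (simp add: less_top)
    qed (use w0 \<open>0 \<le> C\<close> \<open>1 \<le> p\<close> in auto)
    also have "(\<integral>\<^sup>+t. ennreal (w t) \<partial>?N) = (\<integral>\<^sup>+t. ennreal (k x t * w t) \<partial>M)"
      using k0 w0 by (simp add: nn_integral_density ennreal_mult)
    finally show ?thesis .
  qed
  show "AE x in M. (\<integral>\<^sup>+t. ennreal (k x t * w t) \<partial>M) < \<infinity>"
    using P_finite by (rule AE_mp) (use mean in \<open>fastforce intro!: AE_I2 intro: le_less_trans\<close>)
  fix J assume J0: "\<And>x. x \<in> space M \<Longrightarrow> 0 \<le> J x"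
    and J: "\<And>x. x \<in> space M \<Longrightarrow> ennreal (J x) \<le> (\<integral>\<^sup>+t. ennreal (k x t * w t) \<partial>M)"
  have "ennreal (J x powr p) \<le> ennreal (C powr (p - 1)) * P x" if x: "x \<in> space M" and Px: "P x \<noteq> \<infinity>" for x
  proof -
    have "J x \<le> C powr (1 - 1 / p) * enn2real (P x) powr (1 / p)"
      using order.trans[OF J[OF x] mean[OF x Px]] by (simp add: ennreal_le_iff)
    then have "J x powr p \<le> (C powr (1 - 1 / p) * enn2real (P x) powr (1 / p)) powr p"
      using J0[OF x] \<open>1 \<le> p\<close> by (intro powr_mono2) auto
    also have "\<dots> = C powr (p - 1) * enn2real (P x)"
      using \<open>0 \<le> C\<close> \<open>1 \<le> p\<close> by (simp add: powr_mult powr_powr left_diff_distrib)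
    finally have "ennreal (J x powr p) \<le> ennreal (C powr (p - 1) * enn2real (P x))"
      by (rule ennreal_leI)
    also have "\<dots> = ennreal (C powr (p - 1)) * P x"
      using Px by (simp add: ennreal_mult less_top)
    finally show ?thesis .
  qed
  then have "(\<integral>\<^sup>+x. ennreal (J x powr p) \<partial>M) \<le> (\<integral>\<^sup>+x. ennreal (C powr (p - 1)) * P x \<partial>M)"
    using P_finite by (intro nn_integral_mono_AE) (auto elim!: AE_mp)
  also have "\<dots> = ennreal (C powr (p - 1)) * (\<integral>\<^sup>+x. P x \<partial>M)"
    by (simp add: nn_integral_cmult)
  also have "\<dots> \<le> ennreal (C powr (p - 1)) * (ennreal C * (\<integral>\<^sup>+t. ennreal (w t powr p) \<partial>M))"
    by (intro mult_left_mono P_le) auto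
  also have "\<dots> = ennreal (C powr (p - 1) * C) * (\<integral>\<^sup>+t. ennreal (w t powr p) \<partial>M)"
    using \<open>0 \<le> C\<close> by (simp add: ennreal_mult mult.assoc)
  also have "C powr (p - 1) * C = C powr p"
    using \<open>0 \<le> C\<close> powr_add[of C "p - 1" 1] by simp
  finally show "(\<integral>\<^sup>+x. ennreal (J x powr p) \<partial>M) \<le> ennreal (C powr p) * (\<integral>\<^sup>+t. ennreal (w t powr p) \<partial>M)" .
qed

section \<open>The weighted measure and the dominating kernel\<close>

text \<open>Difference quotients of an increasing function are nonnegative, and each point of a
  nondegenerate interval is a limit point of it, so the sign passes to the limit even at the end
  points.\<close>

lemma C1_mono_deriv_nonneg:
  assumes "C1_on_interval a b \<phi> \<phi>'" "mono_on {a..b} \<phi>" "a < b" "x \<in> {a..b}"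
  shows "0 \<le> \<phi>' x"
proof -
  have "((\<lambda>y. (\<phi> y - \<phi> x) / (y - x)) \<longlongrightarrow> \<phi>' x) (at x within {a..b})"
    using assms by (auto simp: C1_on_interval_def has_field_derivative_iff)
  moreover have "\<forall>\<^sub>F y in at x within {a..b}. 0 \<le> (\<phi> y - \<phi> x) / (y - x)"
  proof -
    have "0 \<le> (\<phi> y - \<phi> x) / (y - x)" if "y \<in> {a..b}" for y
      using mono_onD[OF assms(2), of x y] mono_onD[OF assms(2), of y x] that assms(4)
      by (cases "x \<le> y") (auto simp: divide_nonpos_nonpos)
    then show ?thesis by (auto simp: eventually_at_filter)
  qed
  moreover have "at x within {a..b} \<noteq> bot"
    using assms(3,4) by (simp add: trivial_limit_within islimpt_Icc)
  ultimately show ?thesis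
    by (rule tendsto_lowerbound)
qed

text \<open>The disc is closed because the argument of \<open>A\<close> reaches the radius at
  \<open>x = b\<close>, \<open>t = a\<close>. \<open>A_le\<close> is conditional so that
  \<open>S\<close> can be 0 when \<open>\<phi>\<close> is constant.\<close>

locale frac_kernel =
  fixes a b :: real and \<alpha> \<beta> :: complex and A :: "complex \<Rightarrow> complex" and \<phi> \<phi>' :: "real \<Rightarrow> real" and S :: real
  assumes ab: "a < b" and \<alpha>: "0 < Re \<alpha>" and \<beta>: "0 < Re \<beta>"
    and A_cont: "continuous_on (cball 0 ((\<phi> b - \<phi> a) powr Re \<beta>)) A"
    and S0: "0 \<le> S"
    and A_le: "\<And>\<tau>. \<phi> a < \<phi> b \<Longrightarrow> cmod \<tau> \<le> (\<phi> b - \<phi> a) powr Re \<beta> \<Longrightarrow> cmod (A \<tau>) \<le> S"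
    and C1: "C1_on_interval a b \<phi> \<phi>'"
    and mono: "mono_on {a..b} \<phi>"
begin

abbreviation "M \<equiv> lebesgue_on {a..b}"
abbreviation "\<mu> \<equiv> phi_measure a b \<phi>'"

definition "C = (\<phi> b - \<phi> a) powr Re \<alpha> / Re \<alpha>"

text \<open>Since \<open>0 powr s = 0\<close>, the kernel vanishes wherever
  \<open>\<phi> x = \<phi> t\<close>, in particular on the diagonal.\<close>

definition k :: "real \<Rightarrow> real \<Rightarrow> real" where
  "k x t = S * ((\<phi> x - \<phi> t) powr (Re \<alpha> - 1) * indicator {t..} x)"

lemma C_nonneg: "0 \<le> C"
  using \<alpha> by (simp add: C_def)

lemma k_nonneg: "0 \<le> k x t"
  using S0 by (simp add: k_def)

lemma deriv: "x \<in> {a..b} \<Longrightarrow> (\<phi> has_real_derivative \<phi>' x) (at x within {a..b})"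
  using C1 by (simp add: C1_on_interval_def)

lemma deriv_cont: "continuous_on {a..b} \<phi>'"
  using C1 by (simp add: C1_on_interval_def)

lemma deriv_nonneg: "x \<in> {a..b} \<Longrightarrow> 0 \<le> \<phi>' x"
  using C1_mono_deriv_nonneg[OF C1 mono ab] .

lemma phi_cont: "continuous_on {a..b} \<phi>"
  using deriv by (rule DERIV_continuous_on)

lemma phi_le: "a \<le> x \<Longrightarrow> x \<le> y \<Longrightarrow> y \<le> b \<Longrightarrow> \<phi> x \<le> \<phi> y"
  using mono_onD[OF mono, of x y] by auto

lemma phi_measurable [measurable]: "\<phi> \<in> borel_measurable M"
  using phi_cont by (rule continuous_imp_measurable_on_sets_lebesgue) auto

lemma deriv_measurable [measurable]: "\<phi>' \<in> borel_measurable M"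
  using deriv_cont by (rule continuous_imp_measurable_on_sets_lebesgue) auto

lemma ident_measurable [measurable]: "(\<lambda>x. x) \<in> borel_measurable M"
  by (rule continuous_imp_measurable_on_sets_lebesgue) auto

lemma space_mu [simp]: "space \<mu> = {a..b}"
  by (simp add: phi_measure_def)

lemma sets_mu [measurable_cong]: "sets \<mu> = sets M"
  by (simp add: phi_measure_def)

lemma AE_mu_iff: "(AE x in \<mu>. P x) \<longleftrightarrow> (AE x in M. 0 < \<phi>' x \<longrightarrow> P x)"
  unfolding phi_measure_def by (subst AE_density) auto

lemma nn_integral_mu:
  assumes "f \<in> borel_measurable M"
  shows "(\<integral>\<^sup>+x. f x \<partial>\<mu>) = (\<integral>\<^sup>+x. ennreal (\<phi>' x) * f x \<partial>M)"
  unfolding phi_measure_def using assms by (intro nn_integral_density) auto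

lemma sigma_finite_M: "sigma_finite_measure M"
  by (intro finite_measure.axioms(1) finite_measure_lebesgue_on) auto

lemma sigma_finite_mu: "sigma_finite_measure \<mu>"
  unfolding phi_measure_def
  by (subst sigma_finite_measure.sigma_finite_iff_density_finite[OF sigma_finite_M]) auto

lemma restrict_eq:
  assumes "u \<in> {a..b}" "v \<in> {a..b}"
  shows "lebesgue_on {u..v} = restrict_space M {u..v}"
  using assms by (subst restrict_restrict_space) (auto intro!: arg_cong2[where f = restrict_space])

lemma sets_Icc: "{u..v} \<inter> space M \<in> sets M"
  by (auto simp: sets_restrict_space intro!: image_eqI[where x = "{u..v}"])

text \<open>In other words, \<open>\<phi>\<close> pushes \<open>\<mu>\<close> on
  \<open>{u..v}\<close> forward to Lebesgue measure on \<open>{\<phi> u..\<phi> v}\<close>. A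
  plateau of \<open>\<phi>\<close> has no \<open>\<mu>\<close>-mass and maps to a single
  point.\<close>

lemma nn_integral_sub:
  assumes "u \<in> {a..b}" "v \<in> {a..b}" "u < v" and [measurable]: "f \<in> borel_measurable borel"
  shows "(\<integral>\<^sup>+x. f (\<phi> x) * indicator {u..v} x \<partial>\<mu>) = (\<integral>\<^sup>+y. f y * indicator {\<phi> u..\<phi> v} y \<partial>lborel)"
proof -
  have sub: "{u..v} \<subseteq> {a..b}" using assms by auto
  have "(\<integral>\<^sup>+x. f (\<phi> x) * indicator {u..v} x \<partial>\<mu>) =
      (\<integral>\<^sup>+x. f (\<phi> x) * ennreal (\<phi>' x) * indicator {u..v} x \<partial>M)"
    by (subst nn_integral_mu) (auto intro!: nn_integral_cong simp: mult_ac)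
  also have "\<dots> = (\<integral>\<^sup>+x. f (\<phi> x) * ennreal (\<phi>' x) \<partial>lebesgue_on {u..v})"
    by (simp only: restrict_eq[OF assms(1,2)] nn_integral_restrict_space[OF sets_Icc])
  also have "\<dots> = (\<integral>\<^sup>+y. f y * indicator {\<phi> u..\<phi> v} y \<partial>lborel)"
    using sub assms deriv_nonneg
    by (intro nn_integral_substitution_within)
       (auto intro: DERIV_subset[OF deriv] continuous_on_subset[OF deriv_cont])
  finally show ?thesis .
qed

lemma k_measurable [measurable]: "case_prod k \<in> borel_measurable (M \<Otimes>\<^sub>M M)"
proof -
  have "case_prod k = (\<lambda>(x, t). S * ((\<phi> x - \<phi> t) powr (Re \<alpha> - 1) * (if t \<le> x then 1 else 0)))"
    by (auto simp: k_def indicator_def fun_eq_iff)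
  also have "\<dots> \<in> borel_measurable (M \<Otimes>\<^sub>M M)" by measurable
  finally show ?thesis .
qed

section \<open>Row and column integrals of the kernel\<close>

lemma powr_le_C: "0 \<le> L \<Longrightarrow> L \<le> \<phi> b - \<phi> a \<Longrightarrow> ennreal S * ennreal (L powr Re \<alpha> / Re \<alpha>) \<le> ennreal (C * S)"
  using \<alpha> S0 unfolding C_def
  by (subst ennreal_mult'[symmetric]) (auto intro!: ennreal_leI mult_left_mono divide_right_mono powr_mono2 simp: mult.commute[of _ S])

lemma k_row:
  assumes x: "x \<in> space \<mu>"
  shows "(\<integral>\<^sup>+t. ennreal (k x t) \<partial>\<mu>) \<le> ennreal (C * S)"
proof (cases "a < x")
  case True
  have "(\<integral>\<^sup>+t. ennreal (k x t) \<partial>\<mu>) =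
    (\<integral>\<^sup>+t. ennreal S * (ennreal ((\<phi> x - \<phi> t) powr (Re \<alpha> - 1)) * indicator {a..x} t) \<partial>\<mu>)"
    using S0 by (intro nn_integral_cong) (auto simp: k_def indicator_def ennreal_mult)
  also have "\<dots> = ennreal S * (\<integral>\<^sup>+t. ennreal ((\<phi> x - \<phi> t) powr (Re \<alpha> - 1)) * indicator {a..x} t \<partial>\<mu>)"
    by (intro nn_integral_cmult) measurable
  also have "\<dots> = ennreal S * (\<integral>\<^sup>+y. ennreal ((\<phi> x - y) powr (Re \<alpha> - 1)) * indicator {\<phi> a..\<phi> x} y \<partial>lborel)"
    using x True by (subst nn_integral_sub) auto
  also have "\<dots> = ennreal S * ennreal ((\<phi> x - \<phi> a) powr Re \<alpha> / Re \<alpha>)"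
    using x True phi_le[of a x] \<alpha> by (subst nn_integral_powr_to) auto
  also have "\<dots> \<le> ennreal (C * S)"
    using x phi_le[of a x] phi_le[of x b] by (intro powr_le_C) auto
  finally show ?thesis .
next
  case False
  \<comment> \<open>Here \<open>x = a\<close>, so only \<open>t = a\<close> meets
    \<open>t \<le> x\<close>, and there the base of the power is 0.\<close>
  then have "k x t = 0" if "t \<in> space \<mu>" for t
    using that x by (cases "t = x") (auto simp: k_def)
  then have "(\<integral>\<^sup>+t. ennreal (k x t) \<partial>\<mu>) = (\<integral>\<^sup>+t. 0 \<partial>\<mu>)"
    by (intro nn_integral_cong) auto
  then show ?thesis by simp
qed

lemma k_column:
  assumes t: "t \<in> space \<mu>"
  shows "(\<integral>\<^sup>+x. ennreal (k x t) \<partial>\<mu>) \<le> ennreal (C * S)"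
proof (cases "t < b")
  case True
  have "(\<integral>\<^sup>+x. ennreal (k x t) \<partial>\<mu>) =
    (\<integral>\<^sup>+x. ennreal S * (ennreal ((\<phi> x - \<phi> t) powr (Re \<alpha> - 1)) * indicator {t..b} x) \<partial>\<mu>)"
    using S0 by (intro nn_integral_cong) (auto simp: k_def indicator_def ennreal_mult)
  also have "\<dots> = ennreal S * (\<integral>\<^sup>+x. ennreal ((\<phi> x - \<phi> t) powr (Re \<alpha> - 1)) * indicator {t..b} x \<partial>\<mu>)"
    by (intro nn_integral_cmult) measurable
  also have "\<dots> = ennreal S * (\<integral>\<^sup>+y. ennreal ((y - \<phi> t) powr (Re \<alpha> - 1)) * indicator {\<phi> t..\<phi> b} y \<partial>lborel)"
    using t True by (subst nn_integral_sub[where f = "\<lambda>y. ennreal ((y - \<phi> t) powr (Re \<alpha> - 1))"]) auto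
  also have "\<dots> = ennreal S * ennreal ((\<phi> b - \<phi> t) powr Re \<alpha> / Re \<alpha>)"
    using t True phi_le[of t b] \<alpha> by (subst nn_integral_powr_from) auto
  also have "\<dots> \<le> ennreal (C * S)"
    using t phi_le[of a t] phi_le[of t b] by (intro powr_le_C) auto
  finally show ?thesis .
next
  case False
  then have "k x t = 0" if "x \<in> space \<mu>" for x
    using that t by (cases "x = t") (auto simp: k_def)
  then have "(\<integral>\<^sup>+x. ennreal (k x t) \<partial>\<mu>) = (\<integral>\<^sup>+x. 0 \<partial>\<mu>)"
    by (intro nn_integral_cong) auto
  then show ?thesis by simp
qed

section \<open>The integrand on a fixed measure space\<close>

text \<open>Cutting off by an indicator places the integrals over all intervals
  \<open>{a..x}\<close> on the single measure \<open>M\<close>, so that joint measurability in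
  \<open>x\<close> and \<open>t\<close> makes sense.\<close>

definition F :: "(real \<Rightarrow> complex) \<Rightarrow> real \<Rightarrow> real \<Rightarrow> complex" where
  "F u x t = indicat_real {a..x} t *\<^sub>R frac_integrand A \<alpha> \<beta> \<phi> \<phi>' u x t"

lemma restrict_from_a: "x \<in> {a..b} \<Longrightarrow> lebesgue_on {a..x} = restrict_space M {a..x}"
  using restrict_eq[of a x] ab by simp

lemma integrable_iff:
  assumes "x \<in> {a..b}"
  shows "integrable (lebesgue_on {a..x}) (frac_integrand A \<alpha> \<beta> \<phi> \<phi>' u x) \<longleftrightarrow> integrable M (F u x)"
  unfolding restrict_from_a[OF assms] F_def[abs_def] by (rule integrable_restrict_space[OF sets_Icc])

lemma frac_integral_eq:
  assumes "x \<in> {a..b}"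
  shows "frac_integral A \<alpha> \<beta> \<phi> \<phi>' a u x = (LINT t|M. F u x t)"
  unfolding frac_integral_def restrict_from_a[OF assms] F_def by (rule integral_restrict_space[OF sets_Icc])

lemma arg_le:
  assumes "a \<le> t" "t \<le> x" "x \<le> b"
  shows "cmod (complex_of_real (\<phi> x - \<phi> t) powr \<beta>) \<le> (\<phi> b - \<phi> a) powr Re \<beta>"
proof -
  have "cmod (complex_of_real (\<phi> x - \<phi> t) powr \<beta>) = (\<phi> x - \<phi> t) powr Re \<beta>"
    using phi_le[of t x] assms by (subst norm_powr_real_powr) auto
  also have "\<dots> \<le> (\<phi> b - \<phi> a) powr Re \<beta>"
    using phi_le[of t x] phi_le[of x b] phi_le[of a t] assms \<beta> by (intro powr_mono2) auto
  finally show ?thesis .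
qed

lemma F_measurable:
  assumes [measurable]: "u \<in> borel_measurable M"
  shows "case_prod (F u) \<in> borel_measurable (M \<Otimes>\<^sub>M M)"
proof -
  \<comment> \<open>\<open>A\<close> is unconstrained outside the disc, so it need not be measurable there.\<close>
  define A' where "A' z = (if z \<in> cball 0 ((\<phi> b - \<phi> a) powr Re \<beta>) then A z else 0)" for z
  have [measurable]: "A' \<in> borel_measurable borel"
    unfolding A'_def[abs_def] by (intro borel_measurable_continuous_on_if A_cont) auto
  let ?G = "\<lambda>(x, t). if t \<le> x then frac_integrand A' \<alpha> \<beta> \<phi> \<phi>' u x t else 0"
  have "?G \<in> borel_measurable (M \<Otimes>\<^sub>M M)"
    unfolding frac_integrand_def by measurable
  \<comment> \<open>On the triangle \<open>t \<le> x\<close> the argument of \<open>A\<close> stays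
    in the closed disc, where \<open>A'\<close> and \<open>A\<close> agree.\<close>
  moreover have "case_prod (F u) z = ?G z" if "z \<in> space (M \<Otimes>\<^sub>M M)" for z
    using that arg_le
    by (auto simp: space_pair_measure F_def frac_integrand_def A'_def indicator_def split: prod.splits)
  ultimately show ?thesis
    by (simp cong: measurable_cong)
qed

lemma F_measurable_section:
  assumes "u \<in> borel_measurable M" "x \<in> {a..b}"
  shows "F u x \<in> borel_measurable M"
  using measurable_compose_Pair1[OF _ F_measurable[OF assms(1)], of x] assms(2) by simp

lemma norm_F_le:
  assumes "x \<in> {a..b}" "t \<in> {a..b}"
  shows "cmod (F u x t) \<le> \<phi>' t * (k x t * cmod (u t))"
proof (cases "t \<le> x \<and> \<phi> t < \<phi> x")
  case True
  then have "\<phi> a < \<phi> b"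
    using assms phi_le[of a t] phi_le[of x b] by auto
  then have "cmod (A (complex_of_real (\<phi> x - \<phi> t) powr \<beta>)) \<le> S"
    using arg_le[of t x] assms True by (intro A_le) auto
  moreover have "cmod (complex_of_real (\<phi> x - \<phi> t) powr (\<alpha> - 1)) = (\<phi> x - \<phi> t) powr (Re \<alpha> - 1)"
    using True by (subst norm_powr_real_powr) auto
  ultimately show ?thesis
    using True assms deriv_nonneg[of t]
      mult_left_mono[of "cmod (A (complex_of_real (\<phi> x - \<phi> t) powr \<beta>))" S
        "\<phi>' t * (cmod (u t) * (\<phi> x - \<phi> t) powr (Re \<alpha> - 1))"]
    by (simp add: F_def frac_integrand_def k_def norm_mult mult_ac)
next
  case False
  \<comment> \<open>For \<open>t \<le> x\<close> this is the case
    \<open>\<phi> t = \<phi> x\<close>, where the complex power of 0 is 0 by convention, even for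
    \<open>\<alpha> = 1\<close>.\<close>
  then have "F u x t = 0"
    using assms phi_le[of t x] by (auto simp: F_def frac_integrand_def indicator_def)
  then show ?thesis
    using k_nonneg deriv_nonneg assms by auto
qed

lemma nn_integral_norm_F_le:
  assumes [measurable]: "u \<in> borel_measurable M" and x: "x \<in> {a..b}"
  shows "(\<integral>\<^sup>+t. ennreal (cmod (F u x t)) \<partial>M) \<le> (\<integral>\<^sup>+t. ennreal (k x t * cmod (u t)) \<partial>\<mu>)"
proof -
  have [measurable]: "k x \<in> borel_measurable M"
    using measurable_compose_Pair1[OF _ k_measurable, of x] x by simp
  have "(\<integral>\<^sup>+t. ennreal (cmod (F u x t)) \<partial>M) \<le> (\<integral>\<^sup>+t. ennreal (\<phi>' t) * ennreal (k x t * cmod (u t)) \<partial>M)"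
    using norm_F_le[OF x] deriv_nonneg k_nonneg
    by (intro nn_integral_mono) (auto simp: ennreal_mult[symmetric] intro!: ennreal_leI)
  then show ?thesis by (simp add: nn_integral_mu)
qed

section \<open>The operator on \<open>Lp_phi\<close>\<close>

lemma nn_integral_Lp:
  assumes "u \<in> borel_measurable M"
  shows "(\<integral>\<^sup>+x. ennreal (cmod (u x) powr p) \<partial>\<mu>) = (\<integral>\<^sup>+x. ennreal (cmod (u x) powr p * \<phi>' x) \<partial>M)"
  using assms deriv_nonneg
  by (subst nn_integral_mu) (auto intro!: nn_integral_cong simp: ennreal_mult mult.commute)

lemma Lp_phi_iff:
  "u \<in> Lp_phi p a b \<phi>' \<longleftrightarrow>
    u \<in> borel_measurable M \<and> (\<integral>\<^sup>+x. ennreal (cmod (u x) powr p) \<partial>\<mu>) < \<infinity>"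
  by (auto simp: Lp_phi_def nn_integral_Lp)

text \<open>The conventions agree when the integral is infinite: \<open>enn2real\<close> sends
  infinity to 0, and the Lebesgue integral of a non-integrable function is 0.\<close>

lemma Lp_phi_norm_eq:
  assumes "u \<in> borel_measurable M"
  shows "Lp_phi_norm p a b \<phi>' u = enn2real (\<integral>\<^sup>+x. ennreal (cmod (u x) powr p) \<partial>\<mu>) powr (1 / p)"
  unfolding Lp_phi_norm_def using assms deriv_nonneg
  by (subst integral_eq_nn_integral) (auto simp: nn_integral_Lp)

text \<open>The integral of \<open>|F u x|\<close> is dominated by the transform of
  \<open>|u|\<close> under \<open>k\<close>, which the Schur test shows to be finite for almost
  every \<open>x\<close>.\<close>

lemma AE_integrable_F:
  assumes "u \<in> Lp_phi p a b \<phi>'" "1 \<le> p"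
  shows "AE x in \<mu>. integrable M (F u x)"
proof -
  have [measurable]: "u \<in> borel_measurable M" and fin: "(\<integral>\<^sup>+x. ennreal (cmod (u x) powr p) \<partial>\<mu>) < \<infinity>"
    using assms by (auto simp: Lp_phi_iff)
  have "AE x in \<mu>. (\<integral>\<^sup>+t. ennreal (k x t * cmod (u t)) \<partial>\<mu>) < \<infinity>"
    by (rule Schur_test_finite[where C = "C * S" and p = p])
       (use assms(2) fin k_row k_column k_nonneg C_nonneg S0 sigma_finite_mu in auto)
  then show ?thesis
  proof (rule AE_mp, intro AE_I2 impI)
    fix x assume x: "x \<in> space \<mu>" and "(\<integral>\<^sup>+t. ennreal (k x t * cmod (u t)) \<partial>\<mu>) < \<infinity>"
    then show "integrable M (F u x)"
      using nn_integral_norm_F_le[of u x]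
      by (intro integrableI_bounded F_measurable_section) (auto intro: le_less_trans)
  qed
qed

text \<open>A parameter integral of a jointly measurable function is measurable, also across those
  \<open>x\<close> where it takes the default value 0.\<close>

lemma frac_integral_measurable:
  assumes "u \<in> borel_measurable M"
  shows "frac_integral A \<alpha> \<beta> \<phi> \<phi>' a u \<in> borel_measurable M"
proof -
  interpret sigma_finite_measure M by (rule sigma_finite_M)
  have "(\<lambda>x. LINT t|M. F u x t) \<in> borel_measurable M"
    by (intro borel_measurable_lebesgue_integral F_measurable assms)
  then show ?thesis
    by (subst measurable_cong[OF frac_integral_eq]) auto
qed

lemma frac_integral_bound:
  assumes "u \<in> Lp_phi p a b \<phi>'" "1 \<le> p"
  shows frac_integral_in_Lp: "frac_integral A \<alpha> \<beta> \<phi> \<phi>' a u \<in> Lp_phi p a b \<phi>'"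
    and frac_integral_norm_le:
      "Lp_phi_norm p a b \<phi>' (frac_integral A \<alpha> \<beta> \<phi> \<phi>' a u) \<le> C * S * Lp_phi_norm p a b \<phi>' u"
proof -
  let ?I = "frac_integral A \<alpha> \<beta> \<phi> \<phi>' a u"
  let ?N = "\<lambda>v. \<integral>\<^sup>+x. ennreal (cmod (v x) powr p) \<partial>\<mu>"
  have u[measurable]: "u \<in> borel_measurable M" and fin: "?N u < \<infinity>"
    using assms by (auto simp: Lp_phi_iff)
  \<comment> \<open>The norm inequality for integrals is applied where \<open>F u x\<close> is
    integrable; the remaining points are set to 0 and form a \<open>\<mu>\<close>-null set.\<close>
  have "?N (\<lambda>x. if integrable M (F u x) then ?I x else 0) \<le> ennreal ((C * S) powr p) * ?N u"
  proof (rule Schur_test_bound[where k = k])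
    fix x assume x: "x \<in> space \<mu>"
    show "ennreal (cmod (if integrable M (F u x) then ?I x else 0)) \<le> (\<integral>\<^sup>+t. ennreal (k x t * cmod (u t)) \<partial>\<mu>)"
      using x nn_integral_norm_F_le[OF u, of x] integral_norm_bound_ennreal[of M "F u x"]
      by (auto simp: frac_integral_eq intro: order.trans)
  qed (use assms(2) fin k_row k_column k_nonneg C_nonneg S0 sigma_finite_mu in auto)
  also have "?N (\<lambda>x. if integrable M (F u x) then ?I x else 0) = ?N ?I"
    using AE_integrable_F[OF assms] by (intro nn_integral_cong_AE) (auto elim!: AE_mp)
  finally have le: "?N ?I \<le> ennreal ((C * S) powr p) * ?N u" .
  \<comment> \<open>Passing to reals by \<open>enn2real\<close> preserves an inequality when the
    larger side is finite.\<close>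
  have fin': "ennreal ((C * S) powr p) * ?N u < \<infinity>"
    using fin by (simp add: ennreal_mult_less_top)
  with le frac_integral_measurable[OF u] show "?I \<in> Lp_phi p a b \<phi>'"
    by (auto simp: Lp_phi_iff)
  have "enn2real (?N ?I) \<le> (C * S) powr p * enn2real (?N u)"
    using enn2real_mono[OF le] fin' by (simp add: enn2real_mult)
  then have "enn2real (?N ?I) powr (1 / p) \<le> ((C * S) powr p * enn2real (?N u)) powr (1 / p)"
    using assms(2) by (intro powr_mono2) auto
  also have "\<dots> = C * S * enn2real (?N u) powr (1 / p)"
    using assms(2) C_nonneg S0 by (simp add: powr_mult powr_powr)
  finally show "Lp_phi_norm p a b \<phi>' ?I \<le> C * S * Lp_phi_norm p a b \<phi>' u"
    using u frac_integral_measurable[OF u] by (simp add: Lp_phi_norm_eq)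
qed

text \<open>Where \<open>\<phi>'\<close> vanishes \<open>u\<close> and \<open>v\<close> may differ,
  but the factor \<open>\<phi>' t\<close> kills the integrand there. The integrands therefore agree
  Lebesgue-almost everywhere, and the integrals agree at every \<open>x\<close>.\<close>

lemma frac_integral_cong_AE:
  assumes "u \<in> borel_measurable M" "v \<in> borel_measurable M"
    and ae: "AE t in \<mu>. u t = v t" and x: "x \<in> {a..b}"
  shows "frac_integral A \<alpha> \<beta> \<phi> \<phi>' a u x = frac_integral A \<alpha> \<beta> \<phi> \<phi>' a v x"
proof -
  have "AE t in M. 0 < \<phi>' t \<longrightarrow> u t = v t"
    using ae by (simp add: AE_mu_iff)
  then have "AE t in M. F u x t = F v x t"
  proof (rule AE_mp, intro AE_I2 impI)
    fix t assume "t \<in> space M" "0 < \<phi>' t \<longrightarrow> u t = v t"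
    then show "F u x t = F v x t"
      using deriv_nonneg[of t] by (cases "\<phi>' t = 0") (auto simp: F_def frac_integrand_def)
  qed
  then show ?thesis
    using assms by (simp only: frac_integral_eq) (intro integral_cong_AE F_measurable_section)
qed

lemma frac_integral_linear:
  assumes "integrable M (F u x)" "integrable M (F v x)" and x: "x \<in> {a..b}"
  shows "frac_integral A \<alpha> \<beta> \<phi> \<phi>' a (\<lambda>t. c * u t + d * v t) x =
    c * frac_integral A \<alpha> \<beta> \<phi> \<phi>' a u x + d * frac_integral A \<alpha> \<beta> \<phi> \<phi>' a v x"
proof -
  have "F (\<lambda>t. c * u t + d * v t) x = (\<lambda>t. c * F u x t + d * F v x t)"
    by (rule ext) (simp add: F_def frac_integrand_def algebra_simps)
  then show ?thesis
    using assms by (simp add: frac_integral_eq)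
qed

end

section \<open>The supremum over the open disc as the kernel bound\<close>

theorem theorem4p2:
  fixes a b p R :: real
    and \<alpha> \<beta> :: complex
    and A :: "complex \<Rightarrow> complex"
    and \<phi> \<phi>' :: "real \<Rightarrow> real"
  assumes "a < b"
    and "1 \<le> p"
    and "Re \<alpha> > 0"
    and "Re \<beta> > 0"
    and "R > 0"
    and "R > (\<phi> b - \<phi> a) powr Re \<beta>"
    and "A analytic_on ball 0 R"
    and "C1_on_interval a b \<phi> \<phi>'"
    and "\<And>x. x \<in> {a..b} \<Longrightarrow> 0 \<le> \<phi> x"
    and "mono_on {a..b} \<phi>"
  shows
    "(\<forall>u\<in>Lp_phi p a b \<phi>'.
        (AE x in phi_measure a b \<phi>'.
           integrable (lebesgue_on {a..x}) (frac_integrand A \<alpha> \<beta> \<phi> \<phi>' u x)) \<and>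
        frac_integral A \<alpha> \<beta> \<phi> \<phi>' a u \<in> Lp_phi p a b \<phi>' \<and>
        Lp_phi_norm p a b \<phi>' (frac_integral A \<alpha> \<beta> \<phi> \<phi>' a u)
          \<le> frac_bound A \<alpha> \<beta> \<phi> a b * Lp_phi_norm p a b \<phi>' u) \<and>
     (\<forall>u\<in>Lp_phi p a b \<phi>'. \<forall>v\<in>Lp_phi p a b \<phi>'.
        (AE x in phi_measure a b \<phi>'. u x = v x) \<longrightarrow>
        (AE x in phi_measure a b \<phi>'.
           frac_integral A \<alpha> \<beta> \<phi> \<phi>' a u x = frac_integral A \<alpha> \<beta> \<phi> \<phi>' a v x)) \<and>
     (\<forall>u\<in>Lp_phi p a b \<phi>'. \<forall>v\<in>Lp_phi p a b \<phi>'. \<forall>c d :: complex.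
        AE x in phi_measure a b \<phi>'.
           frac_integral A \<alpha> \<beta> \<phi> \<phi>' a (\<lambda>t. c * u t + d * v t) x =
           c * frac_integral A \<alpha> \<beta> \<phi> \<phi>' a u x + d * frac_integral A \<alpha> \<beta> \<phi> \<phi>' a v x)"
proof -
  let ?r = "(\<phi> b - \<phi> a) powr Re \<beta>"
  \<comment> \<open>If \<open>\<phi>\<close> is constant the supremum ranges over the empty set and has no usable value, but the
    factor in front of it is 0.\<close>
  define S where "S = (if \<phi> a < \<phi> b then SUP \<tau>\<in>{\<tau>. cmod \<tau> < ?r}. cmod (A \<tau>) else 0)"
  have A_cont: "continuous_on (cball 0 ?r) A"
  proof (rule continuous_on_subset)
    show "continuous_on (ball 0 R) A"
      using assms(7) by (intro holomorphic_on_imp_continuous_on analytic_imp_holomorphic)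
  qed (use assms(6) in auto)
  have "\<phi> a \<le> \<phi> b"
    using mono_onD[OF assms(10), of a b] assms(1) by auto
  \<comment> \<open>The supremum runs over the open disc but the bound is wanted on the closed one.
    The radius is positive here, so the closed disc is the closure of the open one and continuity
    extends the bound.\<close>
  have A_le: "cmod (A \<tau>) \<le> S" if "\<phi> a < \<phi> b" "cmod \<tau> \<le> ?r" for \<tau>
  proof -
    have closure: "closure {\<tau>. cmod \<tau> < ?r} = cball 0 ?r"
      using that(1) closure_ball[of ?r "0::complex"] by (simp add: ball_def)
    have cont: "continuous_on (closure {\<tau>. cmod \<tau> < ?r}) (\<lambda>\<tau>. cmod (A \<tau>))"
      unfolding closure by (intro continuous_on_norm A_cont)
    have \<tau>: "\<tau> \<in> closure {\<tau>. cmod \<tau> < ?r}"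
      unfolding closure using that(2) by simp
    \<comment> \<open>Compactness of the closed disc makes the set of values bounded above, so that
      the supremum is a genuine upper bound.\<close>
    have "compact ((\<lambda>\<tau>. cmod (A \<tau>)) ` cball 0 ?r)"
      by (intro compact_continuous_image continuous_on_norm A_cont compact_cball)
    then have "bdd_above ((\<lambda>\<tau>. cmod (A \<tau>)) ` cball 0 ?r)"
      by (intro bounded_imp_bdd_above compact_imp_bounded)
    then have bdd: "bdd_above ((\<lambda>\<tau>. cmod (A \<tau>)) ` {\<tau>. cmod \<tau> < ?r})"
      by (rule bdd_above_mono) auto
    have "cmod (A \<sigma>) \<le> S" if "\<sigma> \<in> {\<tau>. cmod \<tau> < ?r}" for \<sigma>
      unfolding S_def using \<open>\<phi> a < \<phi> b\<close> cSUP_upper[OF that bdd] by simp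
    with cont \<tau> show ?thesis
      by (rule continuous_le_on_closure)
  qed
  have S0: "0 \<le> S"
  proof (cases "\<phi> a < \<phi> b")
    case True
    then show ?thesis using order.trans[OF norm_ge_zero A_le[of 0]] by simp
  qed (simp add: S_def)
  interpret frac_kernel a b \<alpha> \<beta> A \<phi> \<phi>' S
    by unfold_locales (fact assms A_cont A_le S0)+
  have bound: "frac_bound A \<alpha> \<beta> \<phi> a b = C * S"
    using \<open>\<phi> a \<le> \<phi> b\<close> by (auto simp: frac_bound_def C_def S_def)
  show ?thesis
  proof (intro conjI ballI allI impI)
    fix u assume u: "u \<in> Lp_phi p a b \<phi>'"
    show "AE x in \<mu>. integrable (lebesgue_on {a..x}) (frac_integrand A \<alpha> \<beta> \<phi> \<phi>' u x)"
      using AE_integrable_F[OF u assms(2)] by (rule AE_mp) (auto intro!: AE_I2 simp: integrable_iff)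
    show "frac_integral A \<alpha> \<beta> \<phi> \<phi>' a u \<in> Lp_phi p a b \<phi>'"
      using u assms(2) by (rule frac_integral_in_Lp)
    show "Lp_phi_norm p a b \<phi>' (frac_integral A \<alpha> \<beta> \<phi> \<phi>' a u) \<le> frac_bound A \<alpha> \<beta> \<phi> a b * Lp_phi_norm p a b \<phi>' u"
      unfolding bound using u assms(2) by (rule frac_integral_norm_le)
  next
    fix u v assume "u \<in> Lp_phi p a b \<phi>'" "v \<in> Lp_phi p a b \<phi>'" "AE x in \<mu>. u x = v x"
    then show "AE x in \<mu>. frac_integral A \<alpha> \<beta> \<phi> \<phi>' a u x = frac_integral A \<alpha> \<beta> \<phi> \<phi>' a v x"
      by - (rule AE_I2, rule frac_integral_cong_AE, auto simp: Lp_phi_iff)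
  next
    fix u v c d assume u: "u \<in> Lp_phi p a b \<phi>'" and v: "v \<in> Lp_phi p a b \<phi>'"
    from AE_integrable_F[OF u assms(2)] AE_integrable_F[OF v assms(2)] AE_space[of \<mu>]
    show "AE x in \<mu>. frac_integral A \<alpha> \<beta> \<phi> \<phi>' a (\<lambda>t. c * u t + d * v t) x =
        c * frac_integral A \<alpha> \<beta> \<phi> \<phi>' a u x + d * frac_integral A \<alpha> \<beta> \<phi> \<phi>' a v x"
      by eventually_elim (simp add: frac_integral_linear)
  qed
qed

end
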